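(* Let $m\ge 1$ be an integer and let $A$ be an ordered semigroup with identity $1$. The following conditions are equivalent: (1) $A$ is m-regular. (2) For every m-right ideal $R$ and every m-left ideal $L$ of $A$, $(RL]=R\cap L$. (3) For every m-right ideal $R$ and every m-left ideal $L$ of $A$: (a) $(R^{2}]=R$; (b) $(L^{2}]=L$; (c) $(RL]$ is an m-quasi-ideal of $A$. (4) The set $Q_A$ of all m-quasi-ideals of $A$, with the multiplication $Q_1\circ Q_2=(Q_1Q_2]$ for $Q_1,Q_2\in Q_A$, is an m-regular semigroup. (5) Every m-quasi-ideal $Q$ of $A$ satisfies $(QA^{m}Q]=Q$.
   Context: An ordered semigroup $(A,\cdot,\le)$ is a semigroup $(A,\cdot)$ with a partial order $\le$ such that $a\le b$ implies $xa\le xb$ and $ax\le bx$ for all $a,b,x\in A$. Standing assumption: $A$ contains an identity element $1$. For $X,Y\subseteq A$, $XY=\{xy: x\in X, y\in Y\}$, $X^m=X\cdots X$ ($m$ times), and $(X]=\{t\in A: t\le h \text{ for some } h\in X\}$. A subsemigroup is a non-empty subset closed under multiplication. A subsemigroup $L$ (resp. $R$) of $A$ is an m-left ideal (resp. m-right ideal) if $A^mL\subseteq L$ and $(L]=L$ (resp. $RA^m\subseteq R$ and $(R]=R$). A subsemigroup $Q$ of $A$ is an m-quasi-ideal if $(A^mQ]\cap(QA^m]\subseteq Q$ and $(Q]=Q$. $A$ is m-regular if for every $a\in A$ there is $x\in A^m$ with $a\le axa$, i.e. $a\in(aA^ma]$. In (4), the statement that $(Q_A,\circ)$ is an m-regular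 semigroup means: $Q_A$ is closed under $\circ$, $\circ$ is associative, and for every $Q\in Q_A$ there exists $X\in Q_A^m$ (that is, $X=P_1\circ\cdots\circ P_m$ with $P_i\in Q_A$) such that $Q=Q\circ X\circ Q$. *)

theory Defs
  imports Main "HOL-Library.Set_Algebras"
begin

class ordered_semigroup_mult = semigroup_mult + order +
  assumes mult_left_mono_le: "a \<le> b \<Longrightarrow> x * a \<le> x * b"
    and mult_right_mono_le: "a \<le> b \<Longrightarrow> a * x \<le> b * x"

text \<open>Products and powers of subsets are the elementwise ones of Set_Algebras. The ordered
  semigroup \<open>A\<close> itself is \<open>UNIV\<close>, so \<open>A\<^sup>m\<close> is \<open>UNIV ^ m\<close>. Note that \<open>X ^ 0 = {1}\<close>.\<close>

class ordered_monoid_mult = ordered_semigroup_mult + monoid_mult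

definition down_closure :: "'a::order set \<Rightarrow> 'a set" where
  "down_closure X = {t. \<exists>h\<in>X. t \<le> h}"

definition subsemigroup :: "'a::semigroup_mult set \<Rightarrow> bool" where
  "subsemigroup X \<longleftrightarrow> X \<noteq> {} \<and> (\<forall>x\<in>X. \<forall>y\<in>X. x * y \<in> X)"

definition m_left_ideal :: "nat \<Rightarrow> 'a::ordered_monoid_mult set \<Rightarrow> bool" where
  "m_left_ideal m L \<longleftrightarrow> subsemigroup L \<and> UNIV ^ m * L \<subseteq> L \<and> down_closure L = L"

definition m_right_ideal :: "nat \<Rightarrow> 'a::ordered_monoid_mult set \<Rightarrow> bool" where
  "m_right_ideal m R \<longleftrightarrow> subsemigroup R \<and> R * UNIV ^ m \<subseteq> R \<and> down_closure R = R"

definition m_quasi_ideal :: "nat \<Rightarrow> 'a::ordered_monoid_mult set \<Rightarrow> bool" where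
  "m_quasi_ideal m Q \<longleftrightarrow> subsemigroup Q \<and>
     down_closure (UNIV ^ m * Q) \<inter> down_closure (Q * UNIV ^ m) \<subseteq> Q \<and> down_closure Q = Q"

definition m_regular :: "'a::ordered_monoid_mult itself \<Rightarrow> nat \<Rightarrow> bool" where
  "m_regular TYPE('a) m \<longleftrightarrow> (\<forall>a::'a. \<exists>x\<in>UNIV ^ m. a \<le> a * x * a)"

definition semigroup_on :: "'b set \<Rightarrow> ('b \<Rightarrow> 'b \<Rightarrow> 'b) \<Rightarrow> bool" where
  "semigroup_on S f \<longleftrightarrow> (\<forall>x\<in>S. \<forall>y\<in>S. f x y \<in> S) \<and>
     (\<forall>x\<in>S. \<forall>y\<in>S. \<forall>z\<in>S. f (f x y) z = f x (f y z))"

text \<open>The products of \<open>m\<close> elements of \<open>S\<close>, bracketed to the left. Since there need not be an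
  identity, only \<open>m \<ge> 1\<close> is meaningful (the set is empty for \<open>m = 0\<close>).\<close>

definition products_on :: "'b set \<Rightarrow> ('b \<Rightarrow> 'b \<Rightarrow> 'b) \<Rightarrow> nat \<Rightarrow> 'b set" where
  "products_on S f m = {foldl f p ps | p ps. p \<in> S \<and> set ps \<subseteq> S \<and> Suc (length ps) = m}"

text \<open>Regularity of a semigroup without an order: equality takes the place of \<open>\<le>\<close>.\<close>

definition m_regular_semigroup_on :: "nat \<Rightarrow> 'b set \<Rightarrow> ('b \<Rightarrow> 'b \<Rightarrow> 'b) \<Rightarrow> bool" where
  "m_regular_semigroup_on m S f \<longleftrightarrow> semigroup_on S f \<and>
     (\<forall>q\<in>S. \<exists>x\<in>products_on S f m. q = f (f q x) q)"

definition quasi_mult :: "'a::ordered_monoid_mult set \<Rightarrow> 'a set \<Rightarrow> 'a set" where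
  "quasi_mult Q\<^sub>1 Q\<^sub>2 = down_closure (Q\<^sub>1 * Q\<^sub>2)"

end

theory Submission
  imports Defs
begin

text \<open>Since \<open>A\<close> has an identity, \<open>A\<^sup>m = A\<close>, so \<open>m\<close> plays no role. The element conditions are recovered by
  applying (2), (3) and (5) to the principal ideals \<open>(aA]\<close>, \<open>(Aa]\<close> and to the quasi-ideal
  \<open>(Aa] \<inter> (aA]\<close>, all of which contain \<open>a\<close>; conversely, regularity is used through \<open>a \<le> axa\<close>.
  For (4), \<open>Q A Q \<subseteq> Q\<close> for every quasi-ideal \<open>Q\<close>, and \<open>A\<close> itself is a quasi-ideal, which serves as the
  middle factor \<open>X = A \<circ> \<dots> \<circ> A = A\<close>.\<close>

section \<open>Elementwise products and down-closures\<close>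

lemma set_times_UNIV_UNIV: "(UNIV :: 'a::monoid_mult set) * UNIV = UNIV"
proof -
  have "x \<in> UNIV * UNIV" for x :: 'a
    using set_times_intro[of 1 UNIV x UNIV] by simp
  then show ?thesis
    by auto
qed

lemma set_UNIV_power: "m \<ge> 1 \<Longrightarrow> (UNIV :: 'a::monoid_mult set) ^ m = UNIV"
  by (induction m rule: nat_induct_at_least) (simp_all add: set_times_UNIV_UNIV del: set_one)

lemma ordered_mult_mono:
  fixes a b c d :: "'a::ordered_semigroup_mult"
  assumes "a \<le> b" "c \<le> d"
  shows "a * c \<le> b * d"
  using order_trans[OF mult_left_mono_le[OF assms(2)] mult_right_mono_le[OF assms(1)]] .

lemma down_closure_iff: "t \<in> down_closure X \<longleftrightarrow> (\<exists>h\<in>X. t \<le> h)"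
  by (simp add: down_closure_def)

lemma down_closure_superset: "X \<subseteq> down_closure X"
  by (auto simp: down_closure_iff)

lemma down_closure_idem: "down_closure (down_closure X) = down_closure X"
  by (auto simp: down_closure_def intro: order_trans)

lemma down_closure_mono: "X \<subseteq> Y \<Longrightarrow> down_closure X \<subseteq> down_closure Y"
  unfolding down_closure_iff subset_iff by blast

lemma down_closure_least: "X \<subseteq> Y \<Longrightarrow> down_closure Y = Y \<Longrightarrow> down_closure X \<subseteq> Y"
  using down_closure_mono[of X Y] by simp

lemma set_times_subset_iff: "X * Y \<subseteq> Z \<longleftrightarrow> (\<forall>x\<in>X. \<forall>y\<in>Y. x * y \<in> Z)"
  by (auto simp: set_times_def)

lemma down_closure_times_iff: "t \<in> down_closure (X * Y) \<longleftrightarrow> (\<exists>x\<in>X. \<exists>y\<in>Y. t \<le> x * y)"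
  by (auto simp: down_closure_def set_times_def)

lemma down_closedD: "down_closure X = X \<Longrightarrow> y \<in> X \<Longrightarrow> x \<le> y \<Longrightarrow> x \<in> X"
  using down_closure_iff by blast

text \<open>Compatibility of the order with multiplication carries a bound on a factor over to the
  product. With the mirror statement for the right factor, nested down-closures collapse to a single
  outer one.\<close>

lemma down_closure_times_left:
  fixes X Y :: "'a::ordered_semigroup_mult set"
  shows "down_closure (down_closure X * Y) = down_closure (X * Y)"
proof
  show "down_closure (X * Y) \<subseteq> down_closure (down_closure X * Y)"
    by (simp add: down_closure_mono set_times_mono2 down_closure_superset)
  have "x * y \<in> down_closure (X * Y)" if xy: "x \<in> down_closure X" "y \<in> Y" for x y
  proof -
    obtain x' where "x' \<in> X" "x \<le> x'"
      using xy down_closure_iff by metis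
    moreover from this have "x * y \<le> x' * y"
      by (simp add: mult_right_mono_le)
    ultimately show ?thesis
      using xy unfolding down_closure_times_iff by blast
  qed
  then have "down_closure X * Y \<subseteq> down_closure (X * Y)"
    unfolding set_times_subset_iff by simp
  then show "down_closure (down_closure X * Y) \<subseteq> down_closure (X * Y)"
    by (metis down_closure_mono down_closure_idem)
qed

lemma down_closure_times_right:
  fixes X Y :: "'a::ordered_semigroup_mult set"
  shows "down_closure (X * down_closure Y) = down_closure (X * Y)"
proof
  show "down_closure (X * Y) \<subseteq> down_closure (X * down_closure Y)"
    by (simp add: down_closure_mono set_times_mono2 down_closure_superset)
  have "x * y \<in> down_closure (X * Y)" if xy: "x \<in> X" "y \<in> down_closure Y" for x y
  proof -
    obtain y' where "y' \<in> Y" "y \<le> y'"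
      using xy down_closure_iff by metis
    moreover from this have "x * y \<le> x * y'"
      by (simp add: mult_left_mono_le)
    ultimately show ?thesis
      using xy unfolding down_closure_times_iff by blast
  qed
  then have "X * down_closure Y \<subseteq> down_closure (X * Y)"
    unfolding set_times_subset_iff by simp
  then show "down_closure (X * down_closure Y) \<subseteq> down_closure (X * Y)"
    by (metis down_closure_mono down_closure_idem)
qed

section \<open>The operation \<open>quasi_mult\<close> on sets\<close>

text \<open>Both bracketings collapse to the down-closure of the triple product.\<close>

lemma quasi_mult_assoc:
  "quasi_mult (quasi_mult X Y) Z = quasi_mult X (quasi_mult Y Z)"
  by (simp add: quasi_mult_def down_closure_times_left down_closure_times_right mult.assoc)

lemma quasi_mult_UNIV: "quasi_mult (UNIV :: 'a::ordered_monoid_mult set) UNIV = UNIV"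
  using down_closure_superset by (auto simp: quasi_mult_def set_times_UNIV_UNIV)

lemma UNIV_in_products_on_quasi_mult:
  assumes "m \<ge> 1" "(UNIV :: 'a::ordered_monoid_mult set) \<in> S"
  shows "UNIV \<in> products_on S quasi_mult m"
proof -
  have "foldl quasi_mult UNIV (replicate n UNIV) = (UNIV :: 'a set)" for n
    by (induction n) (simp_all add: quasi_mult_UNIV)
  \<comment> \<open>The start value of the fold is itself a factor, so \<open>m - 1\<close> further
    copies make \<open>m\<close> factors; this uses \<open>m \<ge> 1\<close>.\<close>
  moreover have "Suc (length (replicate (m - 1) UNIV)) = m" "set (replicate (m - 1) UNIV) \<subseteq> S"
    using assms by (auto simp: set_replicate_conv_if)
  ultimately show ?thesis
    unfolding products_on_def mem_Collect_eq using assms(2) by metis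
qed

section \<open>Ideals and quasi-ideals in terms of elements\<close>

context
  fixes m :: nat
  assumes m: "m \<ge> 1"
begin

lemma m_regular_iff: "m_regular TYPE('a::ordered_monoid_mult) m \<longleftrightarrow> (\<forall>a::'a. \<exists>x. a \<le> a * x * a)"
  by (simp add: m_regular_def set_UNIV_power[OF m])

text \<open>As \<open>UNIV ^ m = UNIV\<close>, the ideal condition absorbs arbitrary right factors;
  closure under products is the case of a factor in \<open>R\<close>.\<close>

lemma m_right_ideal_iff:
  "m_right_ideal m R \<longleftrightarrow> R \<noteq> {} \<and> (\<forall>r\<in>R. \<forall>x. r * x \<in> R) \<and> down_closure R = R"
  unfolding m_right_ideal_def subsemigroup_def set_UNIV_power[OF m] set_times_subset_iff by blast

lemma m_left_ideal_iff:
  "m_left_ideal m L \<longleftrightarrow> L \<noteq> {} \<and> (\<forall>l\<in>L. \<forall>x. x * l \<in> L) \<and> down_closure L = L"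
  unfolding m_left_ideal_def subsemigroup_def set_UNIV_power[OF m] set_times_subset_iff by blast

text \<open>Closure under products is automatic: \<open>xy \<in> AQ \<inter> QA\<close> for \<open>x, y \<in> Q\<close>.\<close>

lemma m_quasi_ideal_iff:
  "m_quasi_ideal m Q \<longleftrightarrow> Q \<noteq> {} \<and> down_closure Q = Q \<and>
     (\<forall>t a p q b. p \<in> Q \<longrightarrow> q \<in> Q \<longrightarrow> t \<le> a * p \<longrightarrow> t \<le> q * b \<longrightarrow> t \<in> Q)"
    (is "_ \<longleftrightarrow> _ \<and> _ \<and> ?P")
proof -
  have *: "down_closure (UNIV * Q) \<inter> down_closure (Q * UNIV) \<subseteq> Q \<longleftrightarrow> ?P"
    unfolding subset_iff Int_iff down_closure_times_iff by blast
  have "?P \<Longrightarrow> x \<in> Q \<Longrightarrow> y \<in> Q \<Longrightarrow> x * y \<in> Q" for x y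
    by blast
  then show ?thesis
    unfolding m_quasi_ideal_def subsemigroup_def set_UNIV_power[OF m] * by blast
qed

text \<open>The two bracketings \<open>(p * x) * q\<close> and \<open>p * (x * q)\<close> show that
  the product lies in both \<open>UNIV * Q\<close> and \<open>Q * UNIV\<close>.\<close>

lemma m_quasi_ideal_sandwich:
  assumes "m_quasi_ideal m Q" "p \<in> Q" "q \<in> Q"
  shows "p * x * q \<in> Q"
  using assms unfolding m_quasi_ideal_iff by (metis mult.assoc order_refl)

lemma m_quasi_ideal_sandwich_subset:
  assumes "m_quasi_ideal m Q"
  shows "down_closure (Q * X * Q) \<subseteq> Q"
proof -
  have "Q * X * Q \<subseteq> Q"
    using m_quasi_ideal_sandwich[OF assms] by (auto simp: set_times_def)
  then show ?thesis
    using assms by (simp add: m_quasi_ideal_iff down_closure_least)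
qed

text \<open>A bound \<open>t \<le> q * b\<close> puts \<open>t\<close> into \<open>R\<close>, and
  \<open>t \<le> a * p\<close> puts it into \<open>L\<close>. This serves for the quasi-ideal
  generated from principal ideals and, under regularity, for
  \<open>down_closure (R * L)\<close>.\<close>

lemma m_right_ideal_Int_m_left_ideal:
  assumes R: "m_right_ideal m R" and L: "m_left_ideal m L"
  shows "m_quasi_ideal m (R \<inter> L)"
proof -
  obtain r l where "r \<in> R" "l \<in> L"
    using R L unfolding m_right_ideal_iff m_left_ideal_iff by blast
  then have "r * l \<in> R \<inter> L"
    using R L unfolding m_right_ideal_iff m_left_ideal_iff by blast
  moreover have "down_closure (R \<inter> L) = R \<inter> L"
  proof
    show "down_closure (R \<inter> L) \<subseteq> R \<inter> L"
      using R L by (simp add: m_right_ideal_iff m_left_ideal_iff down_closure_least)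
  qed (rule down_closure_superset)
  moreover have "t \<in> R \<inter> L" if "p \<in> R \<inter> L" "q \<in> R \<inter> L" "t \<le> a * p" "t \<le> q * b" for t a p q b
  proof
    show "t \<in> R"
      by (rule down_closedD[of R "q * b"]) (use R that in \<open>simp_all add: m_right_ideal_iff\<close>)
    show "t \<in> L"
      by (rule down_closedD[of L "a * p"]) (use L that in \<open>simp_all add: m_left_ideal_iff\<close>)
  qed
  ultimately show ?thesis
    unfolding m_quasi_ideal_iff by blast
qed

section \<open>Principal one-sided ideals\<close>

lemma principal_m_right_ideal:
  "m_right_ideal m {t. \<exists>x. t \<le> a * x}"
proof -
  have "\<exists>y. t * x \<le> a * y" if "t \<le> a * z" for t x z
    using mult_right_mono_le[OF that] by (auto simp: mult.assoc)
  moreover have "{t. \<exists>x. t \<le> a * x} = down_closure (range (\<lambda>x. a * x))"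
    by (auto simp: down_closure_def)
  then have "down_closure {t. \<exists>x. t \<le> a * x} = {t. \<exists>x. t \<le> a * x}"
    by (simp only: down_closure_idem)
  ultimately show ?thesis
    unfolding m_right_ideal_iff by blast
qed

lemma principal_m_left_ideal:
  "m_left_ideal m {t. \<exists>x. t \<le> x * a}"
proof -
  have "\<exists>y. x * t \<le> y * a" if "t \<le> z * a" for t x z
    using mult_left_mono_le[OF that, of x] by (auto simp: mult.assoc[symmetric])
  moreover have "{t. \<exists>x. t \<le> x * a} = down_closure (range (\<lambda>x. x * a))"
    by (auto simp: down_closure_def)
  then have "down_closure {t. \<exists>x. t \<le> x * a} = {t. \<exists>x. t \<le> x * a}"
    by (simp only: down_closure_idem)
  ultimately show ?thesis
    unfolding m_left_ideal_iff by blast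
qed

lemma mem_principal_ideals:
  fixes a :: "'a::ordered_monoid_mult"
  shows "a \<in> {t. \<exists>x. t \<le> a * x}" "a \<in> {t. \<exists>x. t \<le> x * a}"
  by (auto intro: exI[of _ 1])

text \<open>Common last step of the proofs that recover regularity: the outer factors are replaced
  by their bounds, which yields the witness \<open>y * x * z\<close>.\<close>

lemma le_sandwichI:
  fixes a :: "'a::ordered_monoid_mult"
  assumes "t \<le> p * x * q" "p \<le> a * y" "q \<le> z * a"
  shows "\<exists>w. t \<le> a * w * a"
proof -
  have "p * x * q \<le> (a * y) * x * (z * a)"
    using assms by (intro ordered_mult_mono order_refl)
  then have "t \<le> a * (y * x * z) * a"
    using assms(1) by (auto simp: mult.assoc)
  then show ?thesis ..
qed

section \<open>From regularity to conditions on one-sided ideals\<close>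

text \<open>Absorption gives one inclusion. For the other, \<open>a \<le> (a * x) * a\<close> with
  \<open>a * x\<close> in \<open>R\<close> and \<open>a\<close> in \<open>L\<close>.\<close>

lemma down_closure_times_ideals:
  assumes reg: "m_regular TYPE('a::ordered_monoid_mult) m"
    and R: "m_right_ideal m (R :: 'a set)" and L: "m_left_ideal m L"
  shows "down_closure (R * L) = R \<inter> L"
proof
  have "R * L \<subseteq> R \<inter> L"
    using R L unfolding m_right_ideal_iff m_left_ideal_iff set_times_subset_iff by blast
  then show "down_closure (R * L) \<subseteq> R \<inter> L"
    using R L by (simp add: m_right_ideal_iff m_left_ideal_iff down_closure_least)
  show "R \<inter> L \<subseteq> down_closure (R * L)"
  proof
    fix a assume a: "a \<in> R \<inter> L"
    then obtain x where "a \<le> a * x * a"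
      using reg unfolding m_regular_iff by blast
    moreover have "a * x * a \<in> R * L"
      using a R by (auto simp: m_right_ideal_iff intro!: set_times_intro)
    ultimately show "a \<in> down_closure (R * L)"
      unfolding down_closure_iff by blast
  qed
qed

lemma m_right_ideal_square:
  assumes reg: "m_regular TYPE('a::ordered_monoid_mult) m" and R: "m_right_ideal m (R :: 'a set)"
  shows "down_closure (R ^ 2) = R"
proof
  have "R * R \<subseteq> R"
    using R unfolding m_right_ideal_iff set_times_subset_iff by blast
  then show "down_closure (R ^ 2) \<subseteq> R"
    using R by (simp add: m_right_ideal_iff down_closure_least power2_eq_square)
  show "R \<subseteq> down_closure (R ^ 2)"
  proof
    fix a assume a: "a \<in> R"
    obtain x where "a \<le> a * x * a"
      using reg unfolding m_regular_iff by blast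
    moreover have "a * x * a \<in> R ^ 2"
      using a R by (auto simp: m_right_ideal_iff power2_eq_square intro!: set_times_intro)
    ultimately show "a \<in> down_closure (R ^ 2)"
      unfolding down_closure_iff by blast
  qed
qed

lemma m_left_ideal_square:
  assumes reg: "m_regular TYPE('a::ordered_monoid_mult) m" and L: "m_left_ideal m (L :: 'a set)"
  shows "down_closure (L ^ 2) = L"
proof
  have "L * L \<subseteq> L"
    using L unfolding m_left_ideal_iff set_times_subset_iff by blast
  then show "down_closure (L ^ 2) \<subseteq> L"
    using L by (simp add: m_left_ideal_iff down_closure_least power2_eq_square)
  show "L \<subseteq> down_closure (L ^ 2)"
  proof
    fix a assume a: "a \<in> L"
    obtain x where "a \<le> a * x * a"
      using reg unfolding m_regular_iff by blast
    \<comment> \<open>Bracketed to the right, because \<open>L\<close> absorbs factors on the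
      left.\<close>
    moreover have "a * (x * a) \<in> L ^ 2"
      using a L unfolding power2_eq_square by (intro set_times_intro) (auto simp: m_left_ideal_iff)
    ultimately show "a \<in> down_closure (L ^ 2)"
      unfolding down_closure_iff by (metis mult.assoc)
  qed
qed

section \<open>From conditions on one-sided ideals back to regularity\<close>

lemma m_regular_if_times_ideals:
  assumes "\<And>R L :: 'a::ordered_monoid_mult set. m_right_ideal m R \<Longrightarrow> m_left_ideal m L \<Longrightarrow>
    down_closure (R * L) = R \<inter> L"
  shows "m_regular TYPE('a) m"
  unfolding m_regular_iff
proof
  fix a :: 'a
  have "a \<in> down_closure ({t. \<exists>x. t \<le> a * x} * {t. \<exists>x. t \<le> x * a})"
    by (subst assms[OF principal_m_right_ideal principal_m_left_ideal])
      (intro IntI mem_principal_ideals)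
  \<comment> \<open>The factor \<open>1\<close> only brings the bound into the form that
    \<open>le_sandwichI\<close> expects.\<close>
  then obtain r l x y where "a \<le> r * 1 * l" "r \<le> a * x" "l \<le> y * a"
    unfolding down_closure_times_iff by auto
  then show "\<exists>x. a \<le> a * x * a"
    by (rule le_sandwichI)
qed

text \<open>The square conditions give \<open>a \<le> (r * a) * x\<close> and
  \<open>a \<le> y * (a * l')\<close>, where \<open>r * a\<close> and \<open>a * l'\<close> lie in
  \<open>?R * ?L\<close>. Since \<open>?Q\<close> is a quasi-ideal, these two bounds force
  \<open>a\<close> into \<open>?Q\<close>.\<close>

lemma m_regular_if_squares:
  assumes "\<And>R L :: 'a::ordered_monoid_mult set. m_right_ideal m R \<Longrightarrow> m_left_ideal m L \<Longrightarrow>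
    down_closure (R ^ 2) = R \<and> down_closure (L ^ 2) = L \<and> m_quasi_ideal m (down_closure (R * L))"
  shows "m_regular TYPE('a) m"
  unfolding m_regular_iff
proof
  fix a :: 'a
  let ?R = "{t. \<exists>x. t \<le> a * x}" and ?L = "{t. \<exists>x. t \<le> x * a}"
  let ?Q = "down_closure (?R * ?L)"
  note * = assms[OF principal_m_right_ideal[of a] principal_m_left_ideal[of a]]
  have "a \<in> down_closure (?R * ?R)" "a \<in> down_closure (?L * ?L)"
    using * mem_principal_ideals[of a] by (simp_all only: power2_eq_square)
  then obtain r r' l l' where a: "a \<le> r * r'" "r \<in> ?R" "r' \<in> ?R" "a \<le> l * l'" "l \<in> ?L" "l' \<in> ?L"
    unfolding down_closure_times_iff by blast
  obtain x y where xy: "r' \<le> a * x" "l \<le> y * a"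
    using a by auto
  have "r * a \<in> ?Q" "a * l' \<in> ?Q"
    using a(2,6) mem_principal_ideals[of a]
    by (blast intro: set_times_intro subsetD[OF down_closure_superset])+
  moreover have "a \<le> r * a * x"
    using a(1) mult_left_mono_le[OF xy(1), of r] by (simp add: mult.assoc)
  moreover have "a \<le> y * (a * l')"
    using a(4) mult_right_mono_le[OF xy(2), of l'] by (simp add: mult.assoc)
  ultimately have "a \<in> ?Q"
    using * unfolding m_quasi_ideal_iff by blast
  then obtain r l x y where "a \<le> r * 1 * l" "r \<le> a * x" "l \<le> y * a"
    unfolding down_closure_times_iff by auto
  then show "\<exists>x. a \<le> a * x * a"
    by (rule le_sandwichI)
qed

section \<open>Quasi-ideals and their semigroup\<close>

lemma m_quasi_ideal_UNIV: "m_quasi_ideal m (UNIV :: 'a::ordered_monoid_mult set)"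
  using down_closure_superset by (auto simp: m_quasi_ideal_iff)

text \<open>Regularity doubles \<open>t\<close> to \<open>t * x * t\<close>. Bounding the left copy
  by \<open>v * b\<close> and the right one by \<open>a * u\<close> gives a product that starts in
  \<open>P * Q\<close> and ends in \<open>Q\<close>.\<close>

lemma m_quasi_ideal_quasi_mult:
  assumes reg: "m_regular TYPE('a::ordered_monoid_mult) m"
    and P: "m_quasi_ideal m (P :: 'a set)" and Q: "m_quasi_ideal m Q"
  shows "m_quasi_ideal m (quasi_mult P Q)"
proof -
  obtain p q where "p \<in> P" "q \<in> Q"
    using P Q unfolding m_quasi_ideal_iff by blast
  then have "p * q \<in> quasi_mult P Q"
    unfolding quasi_mult_def down_closure_times_iff by blast
  moreover have "t \<in> quasi_mult P Q"
    if uv: "u \<in> quasi_mult P Q" "v \<in> quasi_mult P Q" "t \<le> a * u" "t \<le> v * b" for t a u v b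
  proof -
    obtain p q p' q' where u: "u \<le> p * q" "p \<in> P" "q \<in> Q" and v: "v \<le> p' * q'" "p' \<in> P" "q' \<in> Q"
      using uv unfolding quasi_mult_def down_closure_times_iff by blast
    obtain x where "t \<le> t * x * t"
      using reg unfolding m_regular_iff by blast
    also have "\<dots> \<le> (v * b) * x * (a * u)"
      using uv by (intro ordered_mult_mono order_refl)
    also have "\<dots> \<le> (p' * q' * b) * x * (a * (p * q))"
      using u v by (intro ordered_mult_mono order_refl)
    \<comment> \<open>Everything from \<open>q'\<close> to \<open>q\<close> is a sandwich between
      elements of \<open>Q\<close>, hence in \<open>Q\<close>, and only \<open>p'\<close> from
      \<open>P\<close> remains in front.\<close>
    also have "\<dots> = p' * (q' * (b * x * a * p) * q)"
      by (simp add: mult.assoc)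
    finally show ?thesis
      using v(2) m_quasi_ideal_sandwich[OF Q v(3) u(3)]
      unfolding quasi_mult_def down_closure_times_iff by blast
  qed
  moreover have "down_closure (quasi_mult P Q) = quasi_mult P Q"
    by (simp add: quasi_mult_def down_closure_idem)
  ultimately show ?thesis
    unfolding m_quasi_ideal_iff by blast
qed

lemma m_quasi_ideal_eq_sandwich:
  assumes reg: "m_regular TYPE('a::ordered_monoid_mult) m" and Q: "m_quasi_ideal m (Q :: 'a set)"
  shows "down_closure (Q * UNIV * Q) = Q"
proof
  show "down_closure (Q * UNIV * Q) \<subseteq> Q"
    by (rule m_quasi_ideal_sandwich_subset[OF Q])
  show "Q \<subseteq> down_closure (Q * UNIV * Q)"
  proof
    fix a assume "a \<in> Q"
    moreover obtain x where "a \<le> a * x * a"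
      using reg unfolding m_regular_iff by blast
    ultimately show "a \<in> down_closure (Q * UNIV * Q)"
      unfolding down_closure_iff by (blast intro: set_times_intro)
  qed
qed

lemma m_regular_semigroup_on_quasi_ideals:
  assumes reg: "m_regular TYPE('a::ordered_monoid_mult) m"
  shows "m_regular_semigroup_on m {Q :: 'a set. m_quasi_ideal m Q} quasi_mult"
proof -
  have "Q = quasi_mult (quasi_mult Q UNIV) Q" if "m_quasi_ideal m Q" for Q :: "'a set"
    using m_quasi_ideal_eq_sandwich[OF reg that]
    by (simp add: quasi_mult_def down_closure_times_left)
  moreover have "UNIV \<in> products_on {Q :: 'a set. m_quasi_ideal m Q} quasi_mult m"
    by (intro UNIV_in_products_on_quasi_mult m) (simp add: m_quasi_ideal_UNIV)
  moreover have "semigroup_on {Q :: 'a set. m_quasi_ideal m Q} quasi_mult"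
    unfolding semigroup_on_def using m_quasi_ideal_quasi_mult[OF reg] quasi_mult_assoc by blast
  ultimately show ?thesis
    unfolding m_regular_semigroup_on_def by blast
qed

text \<open>Whatever middle factor \<open>X\<close> regularity provides, enlarging it to
  \<open>UNIV\<close> only enlarges the product.\<close>

lemma sandwich_if_m_regular_semigroup_on:
  assumes "m_regular_semigroup_on m {Q :: 'a::ordered_monoid_mult set. m_quasi_ideal m Q} quasi_mult"
    and Q: "m_quasi_ideal m (Q :: 'a set)"
  shows "down_closure (Q * UNIV * Q) = Q"
proof
  show "down_closure (Q * UNIV * Q) \<subseteq> Q"
    by (rule m_quasi_ideal_sandwich_subset[OF Q])
  obtain X where "Q = quasi_mult (quasi_mult Q X) Q"
    using assms unfolding m_regular_semigroup_on_def by blast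
  then have "Q = down_closure (Q * X * Q)"
    by (simp add: quasi_mult_def down_closure_times_left)
  also have "\<dots> \<subseteq> down_closure (Q * UNIV * Q)"
    by (intro down_closure_mono set_times_mono2 subset_UNIV order_refl)
  finally show "Q \<subseteq> down_closure (Q * UNIV * Q)" .
qed

lemma m_regular_if_sandwich:
  assumes "\<And>Q :: 'a::ordered_monoid_mult set. m_quasi_ideal m Q \<Longrightarrow> down_closure (Q * UNIV * Q) = Q"
  shows "m_regular TYPE('a) m"
  unfolding m_regular_iff
proof
  fix a :: 'a
  let ?Q = "{t. \<exists>x. t \<le> a * x} \<inter> {t. \<exists>x. t \<le> x * a}"
  have "m_quasi_ideal m ?Q"
    by (intro m_right_ideal_Int_m_left_ideal principal_m_right_ideal principal_m_left_ideal)
  then have "down_closure (?Q * UNIV * ?Q) = ?Q"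
    by (rule assms)
  then have "a \<in> down_closure (?Q * UNIV * ?Q)"
    using mem_principal_ideals[of a] by simp
  \<comment> \<open>Each member of \<open>?Q\<close> has a bound of either kind; \<open>p\<close>
    takes the one from the right ideal, \<open>q\<close> the one from the left ideal.\<close>
  then obtain p x q y z where "a \<le> p * x * q" "p \<le> a * y" "q \<le> z * a"
    by (auto simp: down_closure_iff set_times_def)
  then show "\<exists>x. a \<le> a * x * a"
    by (rule le_sandwichI)
qed

end

theorem theorem4p15:
  fixes m :: nat
  assumes "m \<ge> 1"
  shows
    "(m_regular TYPE('a::ordered_monoid_mult) m \<longleftrightarrow>
        (\<forall>R L :: 'a set. m_right_ideal m R \<longrightarrow> m_left_ideal m L \<longrightarrow>
           down_closure (R * L) = R \<inter> L)) \<and>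
     (m_regular TYPE('a) m \<longleftrightarrow>
        (\<forall>R L :: 'a set. m_right_ideal m R \<longrightarrow> m_left_ideal m L \<longrightarrow>
           down_closure (R ^ 2) = R \<and> down_closure (L ^ 2) = L \<and>
           m_quasi_ideal m (down_closure (R * L)))) \<and>
     (m_regular TYPE('a) m \<longleftrightarrow>
        m_regular_semigroup_on m {Q :: 'a set. m_quasi_ideal m Q} quasi_mult) \<and>
     (m_regular TYPE('a) m \<longleftrightarrow>
        (\<forall>Q :: 'a set. m_quasi_ideal m Q \<longrightarrow> down_closure (Q * UNIV ^ m * Q) = Q))"
proof (intro conjI)
  note [simp] = set_UNIV_power[OF assms]
  show "m_regular TYPE('a) m \<longleftrightarrow>
      (\<forall>R L :: 'a set. m_right_ideal m R \<longrightarrow> m_left_ideal m L \<longrightarrow> down_closure (R * L) = R \<inter> L)"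
    using down_closure_times_ideals[OF assms] m_regular_if_times_ideals[OF assms] by blast
  \<comment> \<open>Under regularity this set equals \<open>R \<inter> L\<close>.\<close>
  have "m_quasi_ideal m (down_closure (R * L))"
    if "m_regular TYPE('a) m" "m_right_ideal m R" "m_left_ideal m L" for R L :: "'a set"
    using that m_right_ideal_Int_m_left_ideal[OF assms] down_closure_times_ideals[OF assms]
    by metis
  then show "m_regular TYPE('a) m \<longleftrightarrow>
      (\<forall>R L :: 'a set. m_right_ideal m R \<longrightarrow> m_left_ideal m L \<longrightarrow>
         down_closure (R ^ 2) = R \<and> down_closure (L ^ 2) = L \<and>
         m_quasi_ideal m (down_closure (R * L)))"
    using m_right_ideal_square[OF assms] m_left_ideal_square[OF assms]
      m_regular_if_squares[OF assms] by blast
  \<comment> \<open>The way back to regularity passes through condition (5).\<close>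
  show "m_regular TYPE('a) m \<longleftrightarrow>
      m_regular_semigroup_on m {Q :: 'a set. m_quasi_ideal m Q} quasi_mult"
    using m_regular_semigroup_on_quasi_ideals[OF assms] m_regular_if_sandwich[OF assms]
      sandwich_if_m_regular_semigroup_on[OF assms] by blast
  show "m_regular TYPE('a) m \<longleftrightarrow>
      (\<forall>Q :: 'a set. m_quasi_ideal m Q \<longrightarrow> down_closure (Q * UNIV ^ m * Q) = Q)"
    using m_quasi_ideal_eq_sandwich[OF assms] m_regular_if_sandwich[OF assms] by auto
qed

end
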